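(* Let $B \subset A$ be a regular, irreducible, unital inclusion of simple unital $C^*$-algebras (with common unit), and let $E : A \to B$ be a faithful conditional expectation. Let $W = \mathcal{N}_A(B)/\mathcal{U}(B)$ be the Weyl group of the inclusion, and let $\{u_g : g \in W\} \subset \mathcal{N}_A(B)$ be a fixed set of left coset representatives with $u_e = 1$. Then $\{u_g : g \in W\}$ is a unitary orthonormal generalized (right) quasi-basis for $E$; that is, each $u_g$ is unitary, $E(u_g^* u_h) = \delta_{g,h}$ for all $g,h\in W$, and \[ x = \sum_{g \in W} u_g\, E(u_g^* x) \quad \text{for all } x \in A, \] where the sum converges in the Bures topology on $A''$ with respect to $E''$.
   Context: For an inclusion $B\subset A$ of unital $C^*$-algebras with common unit, $\mathcal{N}_A(B)=\{u\in\mathcal{U}(A): uBu^*=B\}$ is the unitary normalizer; the inclusion is regular if $\mathcal{N}_A(B)$ generates $A$ as a $C^*$-algebra, and irreducible if $B'\cap A=\mathbb{C}1$. The Weyl group is the quotient group $W=\mathcal{N}_A(B)/\mathcal{U}(B)$ ($\mathcal{U}(B)$ is a normal subgroup). $A''$ denotes the enveloping von Neumann algebra of $A$ (the strong-operator closure of $A$ in its universal representation); $B''$ is naturally a von Neumann subalgebra of $A''$, and a conditional expectation $E:A\to B$ extends to a normal conditional expectation $E'':A''\to B''$. The Bures topology on $A''$ with respect to $E''$ is the locally convex topology given by the seminorms $\|x\|_\omega=\omega(E''(x^*x))^{1/2}$, $\omega$ ranging over normal states on $B''$. A set $\{\lambda_i\}_{i\in I}\subset A$ is a generalized (right) quasi-basis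 for $E$ if $x=\sum_{i\in I}\lambda_i E(\lambda_i^*x)$ for all $x\in A$, the sum converging in this Bures topology; it is orthonormal if $E(\lambda_i^*\lambda_j)=\delta_{i,j}$ and unitary if all $\lambda_i$ are unitaries. *)

theory Defs
  imports "HOL-Analysis.Analysis"
begin

class cstar_algebra = real_normed_algebra_1 + banach +
  fixes adj :: "'a \<Rightarrow> 'a"
    and cmul :: "complex \<Rightarrow> 'a \<Rightarrow> 'a"
  assumes cmul_of_real: "cmul (complex_of_real r) x = r *\<^sub>R x"
    and cmul_add_right: "cmul c (x + y) = cmul c x + cmul c y"
    and cmul_add_left: "cmul (c + d) x = cmul c x + cmul d x"
    and cmul_mult_scal: "cmul (c * d) x = cmul c (cmul d x)"
    and cmul_mult_left: "cmul c (x * y) = cmul c x * y"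
    and cmul_mult_right: "cmul c (x * y) = x * cmul c y"
    and norm_cmul: "norm (cmul c x) = cmod c * norm x"
    and adj_adj: "adj (adj x) = x"
    and adj_add: "adj (x + y) = adj x + adj y"
    and adj_mult: "adj (x * y) = adj y * adj x"
    and adj_cmul: "adj (cmul c x) = cmul (cnj c) (adj x)"
    and cstar_identity: "norm (adj x * x) = (norm x)\<^sup>2"

instantiation complex :: cstar_algebra
begin
definition adj_complex :: "complex \<Rightarrow> complex" where "adj_complex = cnj"
definition cmul_complex :: "complex \<Rightarrow> complex \<Rightarrow> complex" where "cmul_complex c x = c * x"
instance
proof
  fix r :: real and x y :: complex and c d :: complex
  show "cmul (complex_of_real r) x = r *\<^sub>R x" by (simp add: cmul_complex_def scaleR_conv_of_real)
  show "cmul c (x + y) = cmul c x + cmul c y" by (simp add: cmul_complex_def distrib_left)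
  show "cmul (c + d) x = cmul c x + cmul d x" by (simp add: cmul_complex_def distrib_right)
  show "cmul (c * d) x = cmul c (cmul d x)" by (simp add: cmul_complex_def)
  show "cmul c (x * y) = cmul c x * y" by (simp add: cmul_complex_def)
  show "cmul c (x * y) = x * cmul c y" by (simp add: cmul_complex_def)
  show "norm (cmul c x) = cmod c * norm x" by (simp add: cmul_complex_def norm_mult)
  show "adj (adj x) = x" by (simp add: adj_complex_def)
  show "adj (x + y) = adj x + adj y" by (simp add: adj_complex_def)
  show "adj (x * y) = adj y * adj x" by (simp add: adj_complex_def)
  show "adj (cmul c x) = cmul (cnj c) (adj x)" by (simp add: adj_complex_def cmul_complex_def)
  show "norm (adj x * x) = (norm x)\<^sup>2" by (simp add: adj_complex_def norm_mult power2_eq_square)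
qed
end

context cstar_algebra
begin

definition unitary :: "'a \<Rightarrow> bool" where
  "unitary u \<longleftrightarrow> adj u * u = 1 \<and> u * adj u = 1"

definition star_subalgebra :: "'a set \<Rightarrow> bool" where
  "star_subalgebra C \<longleftrightarrow> 1 \<in> C \<and> (\<forall>x\<in>C. \<forall>y\<in>C. x + y \<in> C \<and> x * y \<in> C)
     \<and> (\<forall>x\<in>C. adj x \<in> C \<and> (\<forall>c. cmul c x \<in> C))"

definition cstar_subalgebra :: "'a set \<Rightarrow> bool" where
  "cstar_subalgebra C \<longleftrightarrow> star_subalgebra C \<and> closed C"

definition cstar_generated :: "'a set \<Rightarrow> 'a set" where
  "cstar_generated S = \<Inter> {C. cstar_subalgebra C \<and> S \<subseteq> C}"

definition closed_ideal_in :: "'a set \<Rightarrow> 'a set \<Rightarrow> bool" where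
  "closed_ideal_in C I \<longleftrightarrow> I \<subseteq> C \<and> 0 \<in> I \<and> closed I
     \<and> (\<forall>x\<in>I. \<forall>y\<in>I. x + y \<in> I) \<and> (\<forall>x\<in>I. \<forall>c. cmul c x \<in> I)
     \<and> (\<forall>x\<in>I. \<forall>a\<in>C. a * x \<in> I \<and> x * a \<in> I)"

definition simple_in :: "'a set \<Rightarrow> bool" where
  "simple_in C \<longleftrightarrow> (\<forall>I. closed_ideal_in C I \<longrightarrow> I = {0} \<or> I = C)"

definition normalizer :: "'a set \<Rightarrow> 'a set" where
  "normalizer B = {u. unitary u \<and> (\<lambda>b. u * b * adj u) ` B = B}"

definition unitary_group :: "'a set \<Rightarrow> 'a set" where
  "unitary_group B = {u \<in> B. unitary u}"

definition weyl_group :: "'a set \<Rightarrow> 'a set set" where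
  "weyl_group B = {(\<lambda>v. u * v) ` unitary_group B | u. u \<in> normalizer B}"

definition regular_incl :: "'a set \<Rightarrow> bool" where
  "regular_incl B \<longleftrightarrow> cstar_generated (normalizer B) = UNIV"

definition irreducible_incl :: "'a set \<Rightarrow> bool" where
  "irreducible_incl B \<longleftrightarrow> {x. \<forall>b\<in>B. x * b = b * x} = range (\<lambda>c. cmul c 1)"

text \<open>Conditional expectation A -> B: a (complex-linear) projection of norm one
  onto B (Tomiyama).\<close>
definition cond_exp :: "'a set \<Rightarrow> ('a \<Rightarrow> 'a) \<Rightarrow> bool" where
  "cond_exp B E \<longleftrightarrow> (\<forall>x y. E (x + y) = E x + E y) \<and> (\<forall>c x. E (cmul c x) = cmul c (E x))
     \<and> (\<forall>x. E x \<in> B) \<and> (\<forall>b\<in>B. E b = b) \<and> (\<forall>x. norm (E x) \<le> norm x)"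

definition faithful_ce :: "('a \<Rightarrow> 'a) \<Rightarrow> bool" where
  "faithful_ce E \<longleftrightarrow> (\<forall>x. E (adj x * x) = 0 \<longrightarrow> x = 0)"

definition state_on :: "'a set \<Rightarrow> ('a \<Rightarrow> complex) \<Rightarrow> bool" where
  "state_on B \<omega> \<longleftrightarrow> (\<forall>x\<in>B. \<forall>y\<in>B. \<omega> (x + y) = \<omega> x + \<omega> y)
     \<and> (\<forall>c. \<forall>x\<in>B. \<omega> (cmul c x) = c * \<omega> x)
     \<and> (\<forall>b\<in>B. \<omega> (adj b * b) \<in> \<real> \<and> Re (\<omega> (adj b * b)) \<ge> 0)
     \<and> \<omega> 1 = 1"

text \<open>Bures convergence (w.r.t. E'') of the unordered sum over I of f to x,
  for x and all partial sums lying in A: for every normal state of B'',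
  i.e. every state of B, the seminorm of the remainder tends to 0 along the
  net of finite subsets.\<close>
definition bures_has_sum :: "'a set \<Rightarrow> ('a \<Rightarrow> 'a) \<Rightarrow> ('i \<Rightarrow> 'a) \<Rightarrow> 'i set \<Rightarrow> 'a \<Rightarrow> bool" where
  "bures_has_sum B E f I x \<longleftrightarrow>
     (\<forall>\<omega>. state_on B \<omega> \<longrightarrow>
        ((\<lambda>F. \<omega> (E (adj (x - sum f F) * (x - sum f F)))) \<longlongrightarrow> 0) (finite_subsets_at_top I))"

end

end

theory Submission
  imports Defs
begin

text \<open>Once \<open>E\<close> is known to be a \<open>B\<close>-bimodule map, every \<open>w\<close> in the normalizer satisfies
  \<open>E w * b = w b w\<^sup>* * E w\<close>, so \<open>w\<^sup>* E w\<close> is scalar by irreducibility and \<open>E w = 0\<close> unless \<open>w \<in> B\<close>;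
  this is orthonormality. The expansion is a finite identity on the dense span of the normalizer,
  and Bessel's inequality carries it over to all \<open>x\<close>.

  The bimodule property is Tomiyama's theorem, usually proved with projections of the bidual.
  Here a norm estimate of Kadison type shows that \<open>E\<close> is a Jordan bimodule map, and
  since the centre of \<open>B\<close> is trivial, a commutator argument upgrades this to a bimodule map.\<close>

section \<open>Elementary calculus in C*-algebras\<close>

text \<open>\<open>cond_exp\<close> records only a contractive linear projection onto
  \<open>B\<close>, so even \<open>E (adj x) = adj (E x)\<close> has to be extracted from norms. The
  device is \<open>self_adjoint_eq_0\<close>: a self-adjoint \<open>d\<close> for which both
  \<open>1 + s d\<close> and \<open>1 - s d\<close> have norm at most 1 + o(s) is zero. Order
  inequalities are therefore phrased as norm bounds with explicit error terms, and an equality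
  arises by perturbing such a bound in a direction of free sign and comparing the terms of lowest
  order. Perturbing a square \<open>a * a\<close> only ever shows the anticommutator
  \<open>h * k + k * h\<close>; this is why the outcome is a Jordan identity, and why separating
  \<open>E (b * x)\<close> from \<open>E (x * b)\<close> needs a further algebraic argument, in
  which irreducibility enters.\<close>

lemma cmul_one [simp]: "cmul 1 x = (x::'a::cstar_algebra)"
  using cmul_of_real[of 1 x] by simp

lemma cmul_neg_one [simp]: "cmul (-1) x = - (x::'a::cstar_algebra)"
  using cmul_of_real[of "-1" x] by simp

lemma cmul_zero_left [simp]: "cmul 0 x = (0::'a::cstar_algebra)"
  using cmul_of_real[of 0 x] by simp

lemma cmul_zero_right [simp]: "cmul c 0 = (0::'a::cstar_algebra)"
  using cmul_add_right[of c 0 "0::'a"] by simp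

lemma cmul_cmul [simp]: "cmul c (cmul d x) = cmul (c * d) (x::'a::cstar_algebra)"
  by (simp add: cmul_mult_scal)

lemma cmul_minus_right [simp]: "cmul c (- x) = - cmul c (x::'a::cstar_algebra)"
  using cmul_add_right[of c x "- x"] by (simp add: eq_neg_iff_add_eq_0 add.commute)

lemma cmul_minus_left [simp]: "cmul (- c) x = - cmul c (x::'a::cstar_algebra)"
  using cmul_add_left[of c "- c" x] by (simp add: eq_neg_iff_add_eq_0 add.commute)

lemma cmul_diff_right: "cmul c (x - y) = cmul c x - cmul c (y::'a::cstar_algebra)"
  using cmul_add_right[of c x "- y"] by simp

lemma mult_cmul_left [simp]: "cmul c x * y = cmul c (x * y :: 'a::cstar_algebra)"
  by (simp add: cmul_mult_left)

lemma mult_cmul_right [simp]: "x * cmul c y = cmul c (x * y :: 'a::cstar_algebra)"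
  by (simp add: cmul_mult_right)

lemma cmul_scaleR [simp]: "cmul c (r *\<^sub>R x) = r *\<^sub>R cmul c (x::'a::cstar_algebra)"
  by (simp add: mult.commute flip: cmul_of_real)

lemma adj_zero [simp]: "adj 0 = (0::'a::cstar_algebra)"
  using adj_add[of 0 "0::'a"] by simp

lemma adj_minus [simp]: "adj (- x) = - adj (x::'a::cstar_algebra)"
  using adj_add[of x "- x"] by (simp add: eq_neg_iff_add_eq_0 add.commute)

lemma adj_diff: "adj (x - y) = adj x - adj (y::'a::cstar_algebra)"
  using adj_add[of x "- y"] by simp

lemma adj_one [simp]: "adj 1 = (1::'a::cstar_algebra)"
  using adj_mult[of "adj 1" "1::'a"] by (simp add: adj_adj)

lemma adj_scaleR [simp]: "adj (r *\<^sub>R x) = r *\<^sub>R adj (x::'a::cstar_algebra)"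
  using adj_cmul[of "complex_of_real r" x] by (simp add: cmul_of_real)

lemma adj_sum: "adj (sum f F) = (\<Sum>i\<in>F. adj (f i :: 'a::cstar_algebra))"
  by (induction F rule: infinite_finite_induct) (auto simp: adj_add)

section \<open>Isometry of the adjoint; real and imaginary parts\<close>

lemma norm_adj [simp]: "norm (adj x) = norm (x::'a::cstar_algebra)"
proof -
  have le: "norm y \<le> norm (adj y)" for y :: 'a
  proof (cases "y = 0")
    case False
    have "norm y * norm y \<le> norm (adj y) * norm y"
      using norm_mult_ineq[of "adj y" y] by (simp add: cstar_identity power2_eq_square)
    then show ?thesis using False by simp
  qed simp
  show ?thesis using le[of x] le[of "adj x"] by (simp add: adj_adj)
qed

lemma bounded_linear_adj: "bounded_linear (adj :: 'a::cstar_algebra \<Rightarrow> 'a)"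
  by (rule bounded_linear_intro[where K = 1]) (auto simp: adj_add)

lemma continuous_on_adj [continuous_intros]:
  "continuous_on S f \<Longrightarrow> continuous_on S (\<lambda>x. adj (f x :: 'a::cstar_algebra))"
  by (rule bounded_linear.continuous_on[OF bounded_linear_adj])

lemma bounded_linear_cmul: "bounded_linear (cmul c :: 'a::cstar_algebra \<Rightarrow> 'a)"
  by (rule bounded_linear_intro[where K = "cmod c"]) (auto simp: cmul_add_right norm_cmul)

text \<open>The explicit formulas for \<open>h\<close> and \<open>k\<close> are part of the
  conclusion because membership in a subalgebra, or in the kernel of \<open>E\<close>, is read off
  from them.\<close>

lemma cartesian_decomposition:
  fixes x :: "'a::cstar_algebra"
  obtains h k where "adj h = h" "adj k = k" "x = h + cmul \<i> k" "norm h \<le> norm x" "norm k \<le> norm x"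
    "h = (1/2) *\<^sub>R (x + adj x)" "k = cmul (- \<i> / 2) (x - adj x)"
proof
  let ?h = "(1/2) *\<^sub>R (x + adj x)" and ?k = "cmul (- \<i> / 2) (x - adj x)"
  show "adj ?h = ?h" by (simp add: adj_add adj_adj add.commute)
  show "adj ?k = ?k" by (simp add: adj_cmul adj_diff adj_adj cmul_diff_right)
  have "cmul \<i> ?k = (1/2) *\<^sub>R (x - adj x)"
    using cmul_of_real[of "1/2" "x - adj x"] by simp
  then have "?h + cmul \<i> ?k = (1/2) *\<^sub>R (x + x)" by (simp add: algebra_simps)
  then show "x = ?h + cmul \<i> ?k" by (simp add: scaleR_half_double)
  show "norm ?h \<le> norm x" using norm_triangle_ineq[of x "adj x"] by simp
  show "norm ?k \<le> norm x" using norm_triangle_ineq4[of x "adj x"] by (simp add: norm_cmul norm_divide)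
qed (rule refl)+

text \<open>With the C*-identity this turns norms of non-self-adjoint elements into sums of squares;
  the cross term is a commutator and vanishes when \<open>p\<close> and \<open>q\<close>
  commute.\<close>

lemma adj_mult_cartesian:
  fixes p q :: "'a::cstar_algebra"
  assumes "adj p = p" "adj q = q"
  shows "adj (p + cmul \<i> q) * (p + cmul \<i> q) = p * p + q * q + cmul \<i> (p * q - q * p)"
  using assms by (simp add: adj_add adj_cmul algebra_simps cmul_diff_right)

lemma norm_imaginary_part_le:
  fixes h k :: "'a::cstar_algebra"
  assumes "adj h = h" "adj k = k"
  shows "norm h \<le> norm (h + cmul \<i> k)" and "norm k \<le> norm (h + cmul \<i> k)"
proof -
  let ?x = "h + cmul \<i> k"
  have a: "adj ?x = h - cmul \<i> k" using assms by (simp add: adj_add adj_cmul)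
  have "2 *\<^sub>R h = ?x + adj ?x" unfolding a by (simp add: scaleR_2)
  then have "2 * norm h \<le> 2 * norm ?x"
    using norm_triangle_ineq[of ?x "adj ?x"] norm_scaleR[of 2 h] norm_adj[of ?x] by simp
  then show "norm h \<le> norm ?x" by simp
  have "2 *\<^sub>R cmul \<i> k = ?x - adj ?x" unfolding a by (simp add: scaleR_2)
  then have "2 * norm (cmul \<i> k) \<le> 2 * norm ?x"
    using norm_triangle_ineq4[of ?x "adj ?x"] norm_scaleR[of 2 "cmul \<i> k"] norm_adj[of ?x] by simp
  then show "norm k \<le> norm ?x" by (simp add: norm_cmul)
qed

lemma cstar_subalgebraD:
  fixes C :: "'a::cstar_algebra set"
  assumes "cstar_subalgebra C"
  shows "1 \<in> C" "x \<in> C \<Longrightarrow> y \<in> C \<Longrightarrow> x + y \<in> C" "x \<in> C \<Longrightarrow> y \<in> C \<Longrightarrow> x * y \<in> C"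
    "x \<in> C \<Longrightarrow> adj x \<in> C" "x \<in> C \<Longrightarrow> cmul c x \<in> C" "closed C" "0 \<in> C"
    "x \<in> C \<Longrightarrow> r *\<^sub>R x \<in> C" "x \<in> C \<Longrightarrow> - x \<in> C" "x \<in> C \<Longrightarrow> y \<in> C \<Longrightarrow> x - y \<in> C"
proof -
  note * = assms[unfolded cstar_subalgebra_def star_subalgebra_def]
  show 1: "1 \<in> C" "x \<in> C \<Longrightarrow> y \<in> C \<Longrightarrow> x + y \<in> C" "x \<in> C \<Longrightarrow> y \<in> C \<Longrightarrow> x * y \<in> C"
    "x \<in> C \<Longrightarrow> adj x \<in> C" "closed C" for x y
    using * by auto
  show c: "x \<in> C \<Longrightarrow> cmul c x \<in> C" for c x using * by auto
  show "0 \<in> C" using c[of 1 0] 1(1) by simp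
  show "x \<in> C \<Longrightarrow> r *\<^sub>R x \<in> C" using c[of x "complex_of_real r"] by (simp add: cmul_of_real)
  show m: "x \<in> C \<Longrightarrow> - x \<in> C" for x using c[of x "-1"] by simp
  show "x \<in> C \<Longrightarrow> y \<in> C \<Longrightarrow> x - y \<in> C" using 1(2)[of x "- y"] m by simp
qed

text \<open>The root is \<open>1 - z\<close>, where \<open>z\<close> is the fixed point of the contraction \<open>z \<mapsto> (y + z\<^sup>2) / 2\<close>.\<close>

lemma sqrt_one_minus:
  fixes y :: "'a::cstar_algebra"
  assumes sa: "adj y = y" and small: "norm y < 1"
  obtains r where "adj r = r" "r * r = 1 - y" "\<And>c. c * y = y * c \<Longrightarrow> c * r = r * c"
    "\<And>C. cstar_subalgebra C \<Longrightarrow> y \<in> C \<Longrightarrow> r \<in> C"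
proof -
  \<comment> \<open>Every property wanted of the fixed point is a closed condition preserved by
    \<open>T\<close>. Building them all into the complete set \<open>S\<close> makes the Banach
    fixed point inherit them.\<close>
  define S where "S = cball 0 (norm y) \<inter> {z. adj z = z} \<inter> (\<Inter>c\<in>{c. c * y = y * c}. {z. c * z = z * c})
    \<inter> \<Inter> {C. cstar_subalgebra C \<and> y \<in> C}"
  define T where "T z = (1/2) *\<^sub>R (y + z * z)" for z
  have S: "z \<in> S \<longleftrightarrow> norm z \<le> norm y \<and> adj z = z \<and> (\<forall>c. c * y = y * c \<longrightarrow> c * z = z * c)
      \<and> (\<forall>C. cstar_subalgebra C \<longrightarrow> y \<in> C \<longrightarrow> z \<in> C)" for z
    unfolding S_def by auto
  have "closed S" unfolding S_def
    by (intro closed_Int closed_INT closed_Inter ballI closed_cball closed_Collect_eq continuous_intros)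
       (auto simp: cstar_subalgebraD(6))
  then have "complete S" by (simp add: complete_eq_closed)
  moreover have "0 \<in> S" by (simp add: S cstar_subalgebraD)
  moreover have "T ` S \<subseteq> S"
  proof safe
    fix z assume z: "z \<in> S"
    have nz: "norm z \<le> norm y" and az: "adj z = z" using z unfolding S by blast+
    have "norm (z * z) \<le> norm z * norm z" by (rule norm_mult_ineq)
    also have "\<dots> \<le> norm y * 1" using nz small by (intro mult_mono) auto
    finally have "norm (T z) \<le> norm y" using norm_triangle_ineq[of y "z * z"] by (simp add: T_def)
    moreover have "adj (T z) = T z" using az sa by (simp add: T_def adj_add adj_mult)
    moreover have "c * T z = T z * c" if c: "c * y = y * c" for c
    proof -
      have "c * z = z * c" using z c unfolding S by blast
      then have "c * (z * z) = z * z * c" by (metis mult.assoc)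
      then show ?thesis using c by (simp add: T_def distrib_left distrib_right)
    qed
    moreover have "T z \<in> C" if C: "cstar_subalgebra C" "y \<in> C" for C
    proof -
      have "z \<in> C" using z C unfolding S by blast
      then show ?thesis unfolding T_def using C by (intro cstar_subalgebraD) auto
    qed
    ultimately show "T z \<in> S" unfolding S by blast
  qed
  moreover have "dist (T z) (T w) \<le> norm y * dist z w" if "z \<in> S" "w \<in> S" for z w
  proof -
    have n: "norm z \<le> norm y" "norm w \<le> norm y" using that unfolding S by blast+
    have "T z - T w = (1/2) *\<^sub>R (z * (z - w) + (z - w) * w)" by (simp add: T_def algebra_simps)
    then have "2 * norm (T z - T w) = norm (z * (z - w) + (z - w) * w)" by simp
    also have "\<dots> \<le> norm z * norm (z - w) + norm (z - w) * norm w"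
      by (intro order_trans[OF norm_triangle_ineq] add_mono norm_mult_ineq)
    also have "\<dots> \<le> norm y * norm (z - w) + norm (z - w) * norm y"
      using n by (intro add_mono mult_mono) auto
    finally show ?thesis by (simp add: dist_norm)
  qed
  ultimately obtain z where z: "z \<in> S" "T z = z"
    using Banach_fix[of S "norm y" T] small by (smt (verit) norm_ge_zero empty_iff)
  show ?thesis
  proof (rule that[of "1 - z"])
    have "adj z = z" using z(1) unfolding S by blast
    then show "adj (1 - z) = 1 - z" by (simp add: adj_diff)
    have "y + z * z = 2 *\<^sub>R z" using arg_cong[OF z(2), of "(*\<^sub>R) 2"] by (simp add: T_def)
    then show "(1 - z) * (1 - z) = 1 - y" by (simp add: algebra_simps scaleR_2)
    show "c * (1 - z) = (1 - z) * c" if "c * y = y * c" for c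
    proof -
      have "c * z = z * c" using z(1) that unfolding S by blast
      then show ?thesis by (simp add: left_diff_distrib right_diff_distrib)
    qed
    show "1 - z \<in> C" if "cstar_subalgebra C" "y \<in> C" for C
    proof -
      have "z \<in> C" using z(1) that unfolding S by blast
      then show ?thesis using that by (intro cstar_subalgebraD)
    qed
  qed
qed

text \<open>The hypotheses make both \<open>\<eta> - d\<close> and \<open>\<eta> + d\<close> squares, hence so is \<open>\<eta>\<^sup>2 - d\<^sup>2 = t\<^sup>2\<close>,
  and \<open>d + i t\<close> is \<open>\<eta>\<close> times a unitary.\<close>

lemma norm_self_adjoint_le:
  fixes d :: "'a::cstar_algebra"
  assumes sa: "adj d = d" and s: "s > 0" and \<eta>: "\<eta> > 0"
    and "norm (1 + s *\<^sub>R d) < 1 + s * \<eta>" "norm (1 - s *\<^sub>R d) < 1 + s * \<eta>"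
  shows "norm d \<le> \<eta>"
proof -
  define m where "m = 1 + s * \<eta>"
  have m: "m > 0" using s \<eta> by (simp add: m_def add_pos_pos)
  \<comment> \<open>Scaled so that \<open>1 - y\<close> and \<open>1 - z\<close> are s/m times
    \<open>\<eta> - d\<close> and \<open>\<eta> + d\<close>; the strict hypotheses become norms
    below 1, as the square root requires.\<close>
  define y z where "y = (1/m) *\<^sub>R (1 + s *\<^sub>R d)" and "z = (1/m) *\<^sub>R (1 - s *\<^sub>R d)"
  have "norm y = norm (1 + s *\<^sub>R d) / m" "norm z = norm (1 - s *\<^sub>R d) / m"
    using m by (simp_all add: y_def z_def)
  then have "norm y < 1" "norm z < 1"
    using assms(4,5) m unfolding m_def[symmetric] by simp_all
  moreover have "adj y = y" "adj z = z" by (simp_all add: y_def z_def adj_add adj_diff sa)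
  ultimately obtain p q where p: "adj p = p" "p * p = 1 - y" "\<And>c. c * y = y * c \<Longrightarrow> c * p = p * c"
    and q: "adj q = q" "q * q = 1 - z" "\<And>c. c * z = z * c \<Longrightarrow> c * q = q * c"
    by (metis sqrt_one_minus)
  have pd: "d * p = p * d" by (rule p(3)) (simp add: y_def distrib_left distrib_right)
  have qd: "d * q = q * d" by (rule q(3)) (simp add: z_def left_diff_distrib right_diff_distrib)
  have pq: "p * q = q * p" by (rule q(3)) (simp add: z_def left_diff_distrib right_diff_distrib pd)
  define t where "t = (m / s) *\<^sub>R (p * q)"
  have t: "adj t = t" by (simp add: t_def adj_mult p(1) q(1) pq)
  have td: "d * t = t * d" using pd qd by (simp add: t_def) (metis mult.assoc)
  have p2: "m *\<^sub>R (p * p) = s *\<^sub>R (\<eta> *\<^sub>R 1 - d)"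
    using m by (simp add: p(2) y_def scaleR_diff_right scaleR_add_right m_def scaleR_add_left)
  have q2: "m *\<^sub>R (q * q) = s *\<^sub>R (\<eta> *\<^sub>R 1 + d)"
    using m by (simp add: q(2) z_def scaleR_diff_right scaleR_add_right m_def scaleR_add_left)
  have "p * q * (p * q) = (p * p) * (q * q)" by (metis pq mult.assoc)
  then have "t * t = (1 / s\<^sup>2) *\<^sub>R ((m *\<^sub>R (p * p)) * (m *\<^sub>R (q * q)))"
    by (simp add: t_def power2_eq_square)
  also have "\<dots> = (\<eta> *\<^sub>R 1 - d) * (\<eta> *\<^sub>R 1 + d)"
    unfolding p2 q2 using s by (simp add: power2_eq_square)
  finally have "d * d + t * t = \<eta>\<^sup>2 *\<^sub>R 1"
    by (simp add: algebra_simps power2_eq_square)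
  then have "adj (d + cmul \<i> t) * (d + cmul \<i> t) = \<eta>\<^sup>2 *\<^sub>R 1"
    by (simp add: adj_mult_cartesian[OF sa t] td)
  then have "(norm (d + cmul \<i> t))\<^sup>2 = \<eta>\<^sup>2" by (simp flip: cstar_identity)
  then have "norm (d + cmul \<i> t) = \<eta>" using \<eta> by simp
  then show ?thesis using norm_imaginary_part_le(1)[OF sa t] by simp
qed

text \<open>To first order in \<open>s\<close>, the norms of \<open>1 + s d\<close> and
  \<open>1 - s d\<close> see the two ends of the spectrum of \<open>d\<close>. A single
  \<open>s\<close> for each \<open>\<eta>\<close> is enough, so estimates with error o(s) can be fed
  in.\<close>

lemma self_adjoint_eq_0:
  fixes d :: "'a::cstar_algebra"
  assumes sa: "adj d = d"
    and ex: "\<And>\<eta>. \<eta> > 0 \<Longrightarrow> \<exists>s>0. norm (1 + s *\<^sub>R d) < 1 + s * \<eta> \<and> norm (1 - s *\<^sub>R d) < 1 + s * \<eta>"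
  shows "d = 0"
proof -
  have "norm d \<le> 0 + \<eta>" if "\<eta> > 0" for \<eta>
    using ex[OF that] norm_self_adjoint_le[OF sa _ that] by auto
  then show ?thesis using field_le_epsilon[of "norm d" 0] by simp
qed

section \<open>Norm-one projections are bimodule maps\<close>

text \<open>Write [a,e] for \<open>a * e - e * a\<close> and q for [y,a]. Since [a, a e] = a [a,e]
  is again a commutator, q [a,e] = 0 for all e in \<open>C\<close>. Taking e =
  \<open>adj q * y\<close> and e = \<open>adj q\<close> leaves \<open>q * adj q * q = 0\<close>, and
  the C*-identity gives q = 0.\<close>

lemma commutes_if_commutes_with_commutators:
  fixes y :: "'a::cstar_algebra"
  assumes C: "cstar_subalgebra C" and y: "y \<in> C" and a: "a \<in> C"
    and comm: "\<And>b c. b \<in> C \<Longrightarrow> c \<in> C \<Longrightarrow> y * (b * c - c * b) = (b * c - c * b) * y"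
  shows "y * a = a * y"
proof -
  define q where "q = y * a - a * y"
  have q: "q \<in> C" unfolding q_def by (intro cstar_subalgebraD[OF C] y a)
  have 1: "q * (a * e - e * a) = 0" if e: "e \<in> C" for e
  proof -
    have "y * (a * (a * e) - (a * e) * a) = (a * (a * e) - (a * e) * a) * y"
      by (rule comm) (intro cstar_subalgebraD[OF C] a e)+
    also have "\<dots> = a * ((a * e - e * a) * y)" by (simp add: algebra_simps)
    also have "\<dots> = a * (y * (a * e - e * a))" by (simp only: comm[OF a e])
    finally show ?thesis by (simp add: q_def algebra_simps)
  qed
  have "q * (a * (adj q * y) - adj q * y * a) = 0"
    by (intro 1 cstar_subalgebraD[OF C] q y)
  moreover have "q * (a * (adj q * y) - adj q * y * a) = q * (a * adj q - adj q * a) * y - q * adj q * q"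
    by (simp add: q_def algebra_simps)
  moreover have "q * (a * adj q - adj q * a) = 0"
    by (intro 1 cstar_subalgebraD[OF C] q)
  ultimately have qqq: "q * adj q * q = 0" by simp
  define p where "p = adj q * q"
  have "adj p * p = adj q * (q * adj q * q)" by (simp add: p_def adj_mult adj_adj mult.assoc)
  then have "norm (adj p * p) = 0" by (simp add: qqq)
  then have "p = 0" by (simp add: cstar_identity)
  then have "norm (adj q * q) = 0" by (simp add: p_def)
  then have "q = 0" by (simp add: cstar_identity)
  then show ?thesis by (simp add: q_def)
qed

locale conditional_expectation =
  fixes B :: "'a::cstar_algebra set" and E :: "'a \<Rightarrow> 'a"
  assumes subalgebra: "cstar_subalgebra B" and expectation: "cond_exp B E"
begin

lemmas B_closed = cstar_subalgebraD[OF subalgebra]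

lemma E_add: "E (x + y) = E x + E y" and E_cmul: "E (cmul c x) = cmul c (E x)"
  and E_in: "E x \<in> B" and E_id: "b \<in> B \<Longrightarrow> E b = b" and E_norm: "norm (E x) \<le> norm x"
  using expectation by (auto simp: cond_exp_def)

lemma E_one [simp]: "E 1 = 1"
  by (simp add: E_id B_closed)

lemma E_zero [simp]: "E 0 = 0"
  by (simp add: E_id B_closed)

lemma E_scaleR: "E (r *\<^sub>R x) = r *\<^sub>R E x"
  using E_cmul[of "complex_of_real r" x] by (simp add: cmul_of_real)

lemma E_minus: "E (- x) = - E x"
  using E_cmul[of "-1" x] by simp

lemma E_diff: "E (x - y) = E x - E y"
  using E_add[of x "- y"] by (simp add: E_minus)

lemma E_sum: "E (sum f F) = (\<Sum>i\<in>F. E (f i))"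
  by (induction F rule: infinite_finite_induct) (auto simp: E_add)

text \<open>The bound \<open>\<parallel>a + i t\<parallel>\<^sup>2 \<le> \<parallel>a\<parallel>\<^sup>2 + t\<^sup>2\<close> leaves no room for an imaginary part of \<open>E a\<close>
  as \<open>t \<rightarrow> \<plusminus>\<infinity>\<close>; here \<open>s = 1 / t\<close>.\<close>

lemma adj_E_self_adjoint:
  assumes a: "adj a = a"
  shows "adj (E a) = E a"
proof -
  obtain h k where hk: "adj h = h" "adj k = k" "E a = h + cmul \<i> k"
    by (rule cartesian_decomposition[of "E a"])
  have bound: "(norm (1 + s *\<^sub>R k))\<^sup>2 \<le> 1 + s\<^sup>2 * (norm a)\<^sup>2" for s :: real
  proof -
    define x where "x = s *\<^sub>R a + cmul \<i> 1"
    have "E x = s *\<^sub>R h + cmul \<i> (1 + s *\<^sub>R k)"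
      by (simp add: x_def E_add E_scaleR E_cmul hk(3) scaleR_add_right cmul_add_right)
    then have "norm (1 + s *\<^sub>R k) \<le> norm (E x)"
      using norm_imaginary_part_le(2)[of "s *\<^sub>R h" "1 + s *\<^sub>R k"] hk by (simp add: adj_add)
    also have "\<dots> \<le> norm x" by (rule E_norm)
    finally have "(norm (1 + s *\<^sub>R k))\<^sup>2 \<le> norm (adj x * x)"
      by (simp add: cstar_identity power_mono)
    also have "adj x * x = s\<^sup>2 *\<^sub>R (a * a) + 1"
      unfolding x_def using a by (subst adj_mult_cartesian) (auto simp: power2_eq_square)
    also have "norm \<dots> \<le> s\<^sup>2 * norm (a * a) + 1"
      by (rule order_trans[OF norm_triangle_ineq]) simp
    also have "\<dots> \<le> s\<^sup>2 * (norm a)\<^sup>2 + 1"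
      by (simp add: power2_eq_square mult_left_mono norm_mult_ineq)
    finally show ?thesis by simp
  qed
  have "k = 0"
  proof (rule self_adjoint_eq_0[OF hk(2)])
    fix \<eta> :: real assume \<eta>: "\<eta> > 0"
    \<comment> \<open>The choice \<open>s = \<eta> / D\<close> bounds the quadratic error by
      \<open>s * \<eta>\<close>, half of the linear term of \<open>(1 + s * \<eta>)\<^sup>2\<close>;
      the summand 1 keeps \<open>D\<close> positive.\<close>
    define D where "D = (norm a)\<^sup>2 + 1"
    define s where "s = \<eta> / D"
    have D: "D > 0" by (simp add: D_def add_nonneg_pos)
    have s: "s > 0" "s * D = \<eta>" using D \<eta> by (simp_all add: s_def)
    have "s\<^sup>2 * (norm a)\<^sup>2 \<le> s * (s * D)" using s by (simp add: D_def power2_eq_square algebra_simps)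
    also have "\<dots> < 2 * s * \<eta> + (s * \<eta>)\<^sup>2" using s \<eta> by (simp add: add_pos_pos)
    finally have "1 + s\<^sup>2 * (norm a)\<^sup>2 < (1 + s * \<eta>)\<^sup>2" by (simp add: power2_eq_square algebra_simps)
    then have "(norm (1 + s *\<^sub>R k))\<^sup>2 < (1 + s * \<eta>)\<^sup>2" "(norm (1 + (- s) *\<^sub>R k))\<^sup>2 < (1 + s * \<eta>)\<^sup>2"
      using bound[of s] bound[of "- s"] by simp_all
    then have "norm (1 + s *\<^sub>R k) < 1 + s * \<eta>" "norm (1 + (- s) *\<^sub>R k) < 1 + s * \<eta>"
      using s \<eta> by (simp_all add: power2_less_imp_less)
    then show "\<exists>s>0. norm (1 + s *\<^sub>R k) < 1 + s * \<eta> \<and> norm (1 - s *\<^sub>R k) < 1 + s * \<eta>"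
      using s by auto
  qed
  then show ?thesis using hk by simp
qed

lemma E_adj: "E (adj x) = adj (E x)"
proof -
  obtain h k where hk: "adj h = h" "adj k = k" "x = h + cmul \<i> k"
    by (rule cartesian_decomposition[of x])
  show ?thesis
    by (simp add: hk(3) adj_add adj_cmul E_add E_diff E_minus E_cmul adj_E_self_adjoint hk(1,2))
qed

text \<open>A form of Kadison's inequality \<open>E (a\<^sup>2) \<ge> (E a)\<^sup>2\<close>, obtained by applying the contraction \<open>E\<close>
  to \<open>1 + i r a - r\<^sup>2 a\<^sup>2 / 2 \<approx> exp (i r a)\<close>.\<close>

lemma kadison_approx:
  assumes a: "adj a = a" and M: "norm a \<le> M" and r: "0 \<le> r" "r \<le> 1"
  shows "norm (1 - r\<^sup>2 *\<^sub>R (E (a * a) - E a * E a)) \<le> 1 + (M ^ 3 + M ^ 4) * r ^ 3"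
proof -
  define h m where "h = E a" and "m = E (a * a)"
  have M0: "0 \<le> M" using norm_ge_zero[of a] M by linarith
  have aa: "adj (a * a) = a * a" by (simp add: adj_mult a)
  have naa: "norm (a * a) \<le> M\<^sup>2"
    unfolding power2_eq_square by (rule order_trans[OF norm_mult_ineq mult_mono]) (use M M0 in auto)
  have nh: "norm h \<le> M" and nm: "norm m \<le> M\<^sup>2" using E_norm M naa order_trans unfolding h_def m_def by blast+
  have ah: "adj h = h" and am: "adj m = m" by (simp_all add: h_def m_def adj_E_self_adjoint a aa)
  define c where "c = (1 - (r\<^sup>2 / 2) *\<^sub>R (a * a)) + cmul \<i> (r *\<^sub>R a)"
  have sq: "(1 - (r\<^sup>2 / 2) *\<^sub>R x) * (1 - (r\<^sup>2 / 2) *\<^sub>R x) = 1 - r\<^sup>2 *\<^sub>R x + (r ^ 4 / 4) *\<^sub>R (x * x)" for x :: 'a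
  proof -
    have "(r\<^sup>2 / 2) *\<^sub>R x + (r\<^sup>2 / 2) *\<^sub>R x = r\<^sup>2 *\<^sub>R x" by (simp flip: scaleR_add_left)
    then show ?thesis
      by (simp add: left_diff_distrib right_diff_distrib power2_eq_square power4_eq_xxxx algebra_simps)
  qed
  have comm: "(1 - (r\<^sup>2 / 2) *\<^sub>R x) * (r *\<^sub>R y) - (r *\<^sub>R y) * (1 - (r\<^sup>2 / 2) *\<^sub>R x)
      = - ((r ^ 3 / 2) *\<^sub>R (x * y - y * x))" for x y :: 'a
    by (simp add: left_diff_distrib right_diff_distrib scaleR_diff_right power2_eq_square power3_eq_cube mult.assoc)
  \<comment> \<open>The second-order terms cancel, as for a truncated unitary exponential, so
    \<open>c\<close> has norm 1 up to order \<open>r ^ 4\<close>.\<close>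
  have "adj c * c = 1 + (r ^ 4 / 4) *\<^sub>R ((a * a) * (a * a))"
    unfolding c_def
    by (subst adj_mult_cartesian, simp_all only: sq comm)
       (simp_all add: adj_diff a aa power2_eq_square mult.assoc)
  then have "(norm c)\<^sup>2 \<le> 1 + (r ^ 4 / 4) * norm ((a * a) * (a * a))"
    using norm_triangle_ineq[of 1 "(r ^ 4 / 4) *\<^sub>R ((a * a) * (a * a))"] by (simp flip: cstar_identity)
  also have "norm ((a * a) * (a * a)) \<le> M ^ 4"
    using order_trans[OF norm_mult_ineq mult_mono[OF naa naa]] M0 by (simp add: power2_eq_square power4_eq_xxxx mult.assoc)
  finally have nc: "(norm c)\<^sup>2 \<le> 1 + (r ^ 4 / 4) * M ^ 4" by (simp add: mult_left_mono)
  define z where "z = (1 - (r\<^sup>2 / 2) *\<^sub>R m) + cmul \<i> (r *\<^sub>R h)"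
  have "z = E c" by (simp add: z_def c_def E_add E_diff E_cmul E_scaleR m_def h_def)
  then have "norm (adj z * z) \<le> (norm c)\<^sup>2" by (simp add: cstar_identity E_norm power_mono)
  then have nz: "norm (adj z * z) \<le> 1 + (r ^ 4 / 4) * M ^ 4" using nc by (rule order_trans)
  \<comment> \<open>\<open>E a\<close> and \<open>E (a * a)\<close> need not commute, and their
    commutator contributes the error of order \<open>r ^ 3\<close>; this is the source of
    \<open>M ^ 3\<close>. The fourth-order terms supply \<open>M ^ 4\<close>.\<close>
  have "1 - r\<^sup>2 *\<^sub>R (m - h * h) = adj z * z - (r ^ 4 / 4) *\<^sub>R (m * m) + cmul \<i> ((r ^ 3 / 2) *\<^sub>R (m * h - h * m))"
  proof -
    have "adj z * z = 1 - r\<^sup>2 *\<^sub>R m + (r ^ 4 / 4) *\<^sub>R (m * m) + r\<^sup>2 *\<^sub>R (h * h) - cmul \<i> ((r ^ 3 / 2) *\<^sub>R (m * h - h * m))"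
      unfolding z_def
      by (subst adj_mult_cartesian, simp_all only: sq comm)
         (simp_all add: adj_diff ah am power2_eq_square)
    then show ?thesis by (simp add: scaleR_diff_right)
  qed
  then have "norm (1 - r\<^sup>2 *\<^sub>R (m - h * h))
      \<le> norm (adj z * z) + norm ((r ^ 4 / 4) *\<^sub>R (m * m)) + norm (cmul \<i> ((r ^ 3 / 2) *\<^sub>R (m * h - h * m)))"
    by (simp only:) (rule order_trans[OF norm_triangle_ineq add_right_mono[OF norm_triangle_ineq4]])
  then have "norm (1 - r\<^sup>2 *\<^sub>R (m - h * h))
      \<le> norm (adj z * z) + (r ^ 4 / 4) * norm (m * m) + (r ^ 3 / 2) * norm (m * h - h * m)"
    using r by (simp add: norm_cmul)
  moreover have "norm (m * m) \<le> M ^ 4"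
    using order_trans[OF norm_mult_ineq mult_mono[OF nm nm]] M0 by (simp add: power2_eq_square power4_eq_xxxx mult.assoc)
  then have "(r ^ 4 / 4) * norm (m * m) \<le> (r ^ 4 / 4) * M ^ 4" by (simp add: mult_left_mono)
  moreover have "norm (m * h) \<le> M ^ 3" "norm (h * m) \<le> M ^ 3"
    using order_trans[OF norm_mult_ineq mult_mono[OF nm nh]] order_trans[OF norm_mult_ineq mult_mono[OF nh nm]] M0
    by (simp_all add: power2_eq_square power3_eq_cube mult.assoc)
  then have "norm (m * h - h * m) \<le> 2 * M ^ 3" using norm_triangle_ineq4[of "m * h" "h * m"] by linarith
  then have "(r ^ 3 / 2) * norm (m * h - h * m) \<le> (r ^ 3 / 2) * (2 * M ^ 3)" using r by (intro mult_left_mono) auto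
  moreover have "r ^ 4 \<le> r ^ 3" using r by (intro power_decreasing) auto
  then have "r ^ 4 * M ^ 4 \<le> r ^ 3 * M ^ 4" using M0 by (intro mult_right_mono) auto
  moreover have "0 \<le> r ^ 3 * M ^ 4" using r M0 by simp
  ultimately show ?thesis using nz unfolding h_def[symmetric] m_def[symmetric]
    by (simp add: algebra_simps)
qed

text \<open>As \<open>E k = 0\<close>, the perturbed element \<open>a = h - \<sigma> r k\<close>
  still has \<open>E a = h\<close>, while \<open>E (a * a) - E a * E a\<close> has first-order term
  \<open>- \<sigma> r d\<close>. A nearly nonnegative quantity whose leading term may take either
  sign has leading term 0.\<close>

lemma E_jordan_self_adjoint:
  assumes h: "adj h = h" "h \<in> B" and k: "adj k = k" "E k = 0"
  shows "E (h * k + k * h) = 0"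
proof -
  define d e where "d = E (h * k + k * h)" and "e = E (k * k)"
  define M where "M = norm h + norm k"
  define C where "C = M ^ 3 + M ^ 4 + norm e"
  have C: "C \<ge> 0" by (simp add: C_def M_def)
  have "adj (h * k + k * h) = h * k + k * h" by (simp add: adj_add adj_mult h k add.commute)
  then have ad: "adj d = d" unfolding d_def by (rule adj_E_self_adjoint)
  have bound: "norm (1 + (\<sigma> * r ^ 5) *\<^sub>R d) \<le> 1 + C * r ^ 6" if r: "0 \<le> r" "r \<le> 1" and \<sigma>: "\<sigma> = 1 \<or> \<sigma> = -1" for r \<sigma> :: real
  proof -
    define a where "a = h - (\<sigma> * r) *\<^sub>R k"
    have aa: "adj a = a" by (simp add: a_def adj_diff h k)
    have Ea: "E a = h" by (simp add: a_def E_diff E_scaleR E_id h k)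
    have \<sigma>2: "(\<sigma> * r) * (\<sigma> * r) = r\<^sup>2" using \<sigma> by (auto simp: power2_eq_square)
    have "a * a = h * h - (\<sigma> * r) *\<^sub>R (h * k + k * h) + ((\<sigma> * r) * (\<sigma> * r)) *\<^sub>R (k * k)"
      by (simp add: a_def left_diff_distrib right_diff_distrib scaleR_add_right scaleR_diff_right)
    then have Eaa: "E (a * a) = h * h - (\<sigma> * r) *\<^sub>R d + r\<^sup>2 *\<^sub>R e"
      by (simp add: \<sigma>2 E_add E_diff E_scaleR d_def e_def E_id B_closed h)
    have "norm ((\<sigma> * r) *\<^sub>R k) \<le> 1 * norm k"
      unfolding norm_scaleR using r \<sigma> by (intro mult_right_mono) auto
    then have na: "norm a \<le> M" using norm_triangle_ineq4[of h "(\<sigma> * r) *\<^sub>R k"] by (simp add: a_def M_def)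
    \<comment> \<open>Parameter \<open>r\<^sup>2\<close> instead of \<open>r\<close>: the term in
      \<open>d\<close> then has order \<open>r ^ 5\<close>, while the Kadison error and the term in
      \<open>e\<close> both have order \<open>r ^ 6\<close>.\<close>
    have "norm (1 - (r\<^sup>2)\<^sup>2 *\<^sub>R (E (a * a) - E a * E a)) \<le> 1 + (M ^ 3 + M ^ 4) * (r\<^sup>2) ^ 3"
      using r by (intro kadison_approx aa na) (auto simp: power_le_one)
    moreover have eq: "1 + (\<sigma> * r ^ 5) *\<^sub>R d = 1 - (r\<^sup>2)\<^sup>2 *\<^sub>R (E (a * a) - E a * E a) + r ^ 6 *\<^sub>R e"
      unfolding Ea Eaa by (simp add: scaleR_diff_right scaleR_add_right power_numeral_reduce mult_ac)
    moreover have "norm (r ^ 6 *\<^sub>R e) = norm e * r ^ 6" using r by simp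
    moreover have "(r\<^sup>2) ^ 3 = r ^ 6" by simp
    ultimately show ?thesis
      using norm_triangle_ineq[of "1 - (r\<^sup>2)\<^sup>2 *\<^sub>R (E (a * a) - E a * E a)" "r ^ 6 *\<^sub>R e"]
      unfolding eq by (simp add: C_def distrib_right mult.commute[of _ "norm e"])
  qed
  have "d = 0"
  proof (rule self_adjoint_eq_0[OF ad])
    fix \<eta> :: real assume \<eta>: "\<eta> > 0"
    define r where "r = min 1 (\<eta> / (C + 1))"
    have r: "0 < r" "r \<le> 1" using \<eta> C by (auto simp: r_def)
    have "r * (C + 1) \<le> \<eta> / (C + 1) * (C + 1)" using C by (intro mult_right_mono) (auto simp: r_def)
    then have "r * (C + 1) \<le> \<eta>" using C by simp
    then have "C * r < \<eta>" using r by (simp add: distrib_left mult.commute)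
    then have "r ^ 5 * (C * r) < r ^ 5 * \<eta>" using r by simp
    then have "C * r ^ 6 < r ^ 5 * \<eta>" by (simp add: power_numeral_reduce mult_ac)
    then have "norm (1 + r ^ 5 *\<^sub>R d) < 1 + r ^ 5 * \<eta>" "norm (1 - r ^ 5 *\<^sub>R d) < 1 + r ^ 5 * \<eta>"
      using bound[of r 1] bound[of r "-1"] r by simp_all
    then show "\<exists>s>0. norm (1 + s *\<^sub>R d) < 1 + s * \<eta> \<and> norm (1 - s *\<^sub>R d) < 1 + s * \<eta>"
      using r by (intro exI[of _ "r ^ 5"]) auto
  qed
  then show ?thesis by (simp add: d_def)
qed

section \<open>Jordan identities for arbitrary elements\<close>

lemma E_jordan_kernel:
  assumes b: "b \<in> B" and x: "E x = 0"
  shows "E (b * x + x * b) = 0"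
proof -
  obtain h k where hk: "adj h = h" "adj k = k" "b = h + cmul \<i> k"
      "h = (1/2) *\<^sub>R (b + adj b)" "k = cmul (- \<i> / 2) (b - adj b)"
    by (rule cartesian_decomposition[of b])
  have "h \<in> B" "k \<in> B" unfolding hk(4,5) by (intro B_closed b)+
  moreover obtain p q where pq: "adj p = p" "adj q = q" "x = p + cmul \<i> q"
      "p = (1/2) *\<^sub>R (x + adj x)" "q = cmul (- \<i> / 2) (x - adj x)"
    by (rule cartesian_decomposition[of x])
  moreover have "E p = 0" "E q = 0"
    unfolding pq(4,5) by (simp_all add: E_scaleR E_add E_cmul E_diff E_minus E_adj x)
  ultimately have J: "E (h * p + p * h) = 0" "E (h * q + q * h) = 0" "E (k * p + p * k) = 0" "E (k * q + q * k) = 0"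
    using E_jordan_self_adjoint hk(1,2) by blast+
  have "b * x + x * b = (h * p + p * h) + cmul \<i> (h * q + q * h) + cmul \<i> (k * p + p * k) - (k * q + q * k)"
    by (simp add: hk(3) pq(3) distrib_left distrib_right cmul_add_right)
  then show ?thesis by (simp only: E_add[of _ "cmul _ _"] E_diff E_cmul J) simp
qed

lemma E_jordan:
  assumes "b \<in> B"
  shows "E (b * z) + E (z * b) = b * E z + E z * b"
proof -
  have "E (b * (z - E z) + (z - E z) * b) = 0"
    by (rule E_jordan_kernel[OF assms]) (simp add: E_diff E_id E_in)
  then have "E (b * z) + E (z * b) - (E (b * E z) + E (E z * b)) = 0"
    by (simp add: right_diff_distrib left_diff_distrib E_add E_diff algebra_simps)
  then show ?thesis using assms by (simp add: E_id E_in B_closed)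
qed

text \<open>With b o x for \<open>b * x + x * b\<close>, the identity c o (b o x) + b o (c o x) - (b
  o c) o x = 2 (b x c + c x b) holds, and each term on the left lies in the kernel of
  \<open>E\<close> because b o x and c o x do.\<close>

lemma E_triple:
  assumes b: "b \<in> B" and c: "c \<in> B" and x: "E x = 0"
  shows "E (b * x * c) + E (c * x * b) = 0"
proof -
  have "E (c * (b * x + x * b) + (b * x + x * b) * c) = 0"
       "E (b * (c * x + x * c) + (c * x + x * c) * b) = 0"
       "E ((b * c + c * b) * x + x * (b * c + c * b)) = 0"
    using b c x by (intro E_jordan_kernel B_closed E_jordan_kernel; simp)+
  moreover have "2 *\<^sub>R (E (b * x * c) + E (c * x * b))
      = E (c * (b * x + x * b) + (b * x + x * b) * c) + E (b * (c * x + x * c) + (c * x + x * c) * b)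
        - E ((b * c + c * b) * x + x * (b * c + c * b))"
    by (simp add: E_add distrib_left distrib_right mult.assoc scaleR_2)
  ultimately show ?thesis by simp
qed

text \<open>Write \<open>f b = E (b * x)\<close>. The Jordan identities give \<open>f (b c) = f (c b)\<close>. Applied to
  \<open>d x - f d\<close> in place of \<open>x\<close>, this shows that \<open>f d\<close> commutes with all commutators of \<open>B\<close>;
  hence it is central, that is, scalar. The same holds for \<open>f (a d) - a f d\<close>,
  so either \<open>f = 0\<close> or \<open>B\<close> consists of scalars.\<close>

lemma E_mult_kernel:
  assumes irr: "irreducible_incl B" and x: "E x = 0" and b: "b \<in> B"
  shows "E (b * x) = 0"
proof -
  have right: "E (z * b) = - E (b * z)" if "b \<in> B" "E z = 0" for b z
    using E_jordan[OF that(1), of z] that(2) by (simp add: eq_neg_iff_add_eq_0 add.commute)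
  have left: "E (c * b * z) + E (b * z * c) = c * E (b * z) + E (b * z) * c"
    if "b \<in> B" "c \<in> B" "E z = 0" for b c z
    using E_jordan[OF that(2), of "b * z"] by (simp add: mult.assoc)
  \<comment> \<open>The Jordan identities for \<open>b * z\<close> and \<open>z * b\<close> have
    opposite right-hand sides, since \<open>E (z * b) = - E (b * z)\<close>. In their sum
    \<open>E_triple\<close> removes the terms with \<open>z\<close> in the middle.\<close>
  have trace: "E (b * c * z) = E (c * b * z)" if bcz: "b \<in> B" "c \<in> B" "E z = 0" for b c z
  proof -
    have "E (c * z * b) - E (b * c * z) = - (c * E (b * z) + E (b * z) * c)"
      using E_jordan[OF bcz(2), of "z * b"] right[OF B_closed(3)[OF bcz(1,2)] bcz(3)] right[OF bcz(1,3)]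
      by (simp add: mult.assoc)
    moreover have "E (c * b * z) - E (b * c * z) + (E (b * z * c) + E (c * z * b))
        = (E (c * z * b) - E (b * c * z)) + (E (c * b * z) + E (b * z * c))"
      by simp
    ultimately have "E (c * b * z) - E (b * c * z) + (E (b * z * c) + E (c * z * b)) = 0"
      by (simp only: left[OF bcz] ab_left_minus)
    then show ?thesis using E_triple[OF bcz] by simp
  qed
  have sum: "E (b * c * z) + E (c * b * z) = c * E (b * z) + E (b * z) * c + b * E (c * z) + E (c * z) * b"
    if bcz: "b \<in> B" "c \<in> B" "E z = 0" for b c z
  proof -
    have "E (b * c * z) + E (c * b * z) + (E (b * z * c) + E (c * z * b))
        = (E (c * b * z) + E (b * z * c)) + (E (b * c * z) + E (c * z * b))"
      by (simp add: algebra_simps)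
    then show ?thesis
      unfolding E_triple[OF bcz] left[OF bcz] left[OF bcz(2,1,3)] by (simp add: add.assoc)
  qed
  have kill: "E ((a * c - c * a) * z) = 0" if "a \<in> B" "c \<in> B" "E z = 0" for a c z
    using trace[OF that] by (simp add: left_diff_distrib E_diff)
  have scalar: "\<exists>l. E (d * z) = cmul l 1" if d: "d \<in> B" and z: "E z = 0" for d z
  proof -
    define y where "y = E (d * z)"
    have y: "y \<in> B" by (simp add: y_def E_in)
    have "y * (a * c - c * a) = (a * c - c * a) * y" if ac: "a \<in> B" "c \<in> B" for a c
    proof -
      define k where "k = a * c - c * a"
      have k: "k \<in> B" unfolding k_def by (intro B_closed ac)
      have "E (k * (d * z - y)) = 0"
        unfolding k_def by (rule kill[OF ac]) (simp add: E_diff E_id y, simp add: y_def)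
      then have ky: "E (k * d * z) = k * y"
        using k y by (simp add: right_diff_distrib E_diff E_id B_closed mult.assoc)
      have "E (k * z) = 0" unfolding k_def by (rule kill[OF ac z])
      \<comment> \<open>In \<open>sum\<close> the terms with \<open>E (k * z)\<close> vanish, and by
        \<open>trace\<close> both summands on its left equal \<open>k * y\<close>.\<close>
      then have "k * y + k * y = k * y + y * k"
        using sum[OF d k z] trace[OF d k z] ky by (simp flip: y_def)
      then show ?thesis by (simp add: k_def)
    qed
    then have "\<forall>b\<in>B. y * b = b * y"
      using commutes_if_commutes_with_commutators[OF subalgebra y] by blast
    then have "y \<in> range (\<lambda>c. cmul c 1)" using irr unfolding irreducible_incl_def by blast
    then show ?thesis by (auto simp: y_def)
  qed
  obtain l where l: "E (b * x) = cmul l 1" using scalar[OF b x] by blast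
  show ?thesis
  proof (cases "l = 0")
    case False
    \<comment> \<open>\<open>scalar\<close>, used for the kernel element
      \<open>b * x - E (b * x)\<close> and for \<open>b * b\<close>, exhibits \<open>l b\<close> as
      a difference of scalars. So \<open>b\<close> is a scalar t and
      \<open>E (b * x) = t E x = 0\<close>.\<close>
    obtain p where p: "E (b * (b * x - E (b * x))) = cmul p 1"
      using scalar[OF b, of "b * x - E (b * x)"] by (auto simp: E_diff E_id E_in)
    obtain q where q: "E (b * b * x) = cmul q 1" using scalar[OF B_closed(3)[OF b b] x] by blast
    have "cmul q 1 - cmul l b = cmul p 1"
      using p q b by (simp add: right_diff_distrib E_diff l mult.assoc E_cmul E_id)
    then have "cmul l b = cmul (q - p) 1"
      using cmul_add_left[of "q - p" p "1::'a"] by (simp add: algebra_simps)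
    then have "cmul (1 / l) (cmul l b) = cmul (1 / l) (cmul (q - p) 1)" by simp
    then obtain t where "b = cmul t 1" using False by auto
    then show ?thesis using x by (simp add: E_cmul)
  qed (simp add: l)
qed

lemma E_mult_left:
  assumes "irreducible_incl B" "b \<in> B"
  shows "E (b * z) = b * E z"
proof -
  have "E (b * (z - E z)) = 0"
    by (rule E_mult_kernel[OF assms(1) _ assms(2)]) (simp add: E_diff E_id E_in)
  then show ?thesis using assms(2) by (simp add: right_diff_distrib E_diff E_id E_in B_closed)
qed

lemma E_mult_right:
  assumes "irreducible_incl B" "b \<in> B"
  shows "E (z * b) = E z * b"
  using E_jordan[OF assms(2), of z] E_mult_left[OF assms, of z] by simp

end
section \<open>The normalizer and its linear span\<close>

lemma unitaryD:
  fixes u :: "'a::cstar_algebra"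
  assumes "unitary u"
  shows "adj u * u = 1" "u * adj u = 1" "adj u * (u * x) = x" "u * (adj u * x) = x"
  using assms by (auto simp: unitary_def simp flip: mult.assoc)

lemma unitary_mult: "unitary u \<Longrightarrow> unitary v \<Longrightarrow> unitary (u * v :: 'a::cstar_algebra)"
  by (simp add: unitary_def adj_mult mult.assoc) (metis mult.assoc mult_1)

lemma unitary_adj: "unitary u \<Longrightarrow> unitary (adj u :: 'a::cstar_algebra)"
  by (simp add: unitary_def adj_adj)

lemma normalizer_unitary: "u \<in> normalizer B \<Longrightarrow> unitary (u :: 'a::cstar_algebra)"
  by (simp add: normalizer_def)

lemma normalizer_conj: "u \<in> normalizer B \<Longrightarrow> b \<in> B \<Longrightarrow> u * b * adj u \<in> (B :: 'a::cstar_algebra set)"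
  by (auto simp: normalizer_def)

lemma normalizer_mult:
  fixes B :: "'a::cstar_algebra set"
  assumes "u \<in> normalizer B" "v \<in> normalizer B"
  shows "u * v \<in> normalizer B"
proof -
  have "(\<lambda>b. u * v * b * adj (u * v)) ` B = (\<lambda>b. u * b * adj u) ` (\<lambda>b. v * b * adj v) ` B"
    by (simp add: image_image adj_mult mult.assoc)
  then show ?thesis using assms by (simp add: normalizer_def unitary_mult)
qed

lemma normalizer_adj:
  fixes B :: "'a::cstar_algebra set"
  assumes u: "u \<in> normalizer B"
  shows "adj u \<in> normalizer B"
proof -
  have "(\<lambda>b. adj u * b * u) ` B = (\<lambda>b. adj u * b * u) ` (\<lambda>b. u * b * adj u) ` B"
    using u by (simp add: normalizer_def)
  also have "\<dots> = B"
    using unitaryD[OF normalizer_unitary[OF u]] by (simp add: image_image mult.assoc)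
  finally show ?thesis using u by (simp add: normalizer_def unitary_adj adj_adj)
qed

lemma unitary_group_subset_normalizer:
  assumes "cstar_subalgebra B"
  shows "unitary_group B \<subseteq> normalizer (B :: 'a::cstar_algebra set)"
proof
  fix v assume v: "v \<in> unitary_group B"
  then have u: "unitary v" and vB: "v \<in> B" by (auto simp: unitary_group_def)
  have "b \<in> (\<lambda>b. v * b * adj v) ` B" if "b \<in> B" for b
  proof
    show "b = v * (adj v * b * v) * adj v" using unitaryD[OF u] by (simp add: mult.assoc)
    show "adj v * b * v \<in> B" by (intro cstar_subalgebraD[OF assms] that vB)
  qed
  moreover have "v * b * adj v \<in> B" if "b \<in> B" for b by (intro cstar_subalgebraD[OF assms] that vB)
  ultimately show "v \<in> normalizer B" using u by (auto simp: normalizer_def)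
qed

lemma cmul_i_normalizer: "u \<in> normalizer B \<Longrightarrow> cmul \<i> u \<in> normalizer (B :: 'a::cstar_algebra set)"
  by (simp add: normalizer_def unitary_def adj_cmul)

section \<open>Density of the span of the normalizer\<close>

lemma linear_span_closed:
  assumes "linear f" "x \<in> span S" "\<And>s. s \<in> S \<Longrightarrow> f s \<in> span S"
  shows "f x \<in> span S"
proof -
  have "subspace {x. f x \<in> span S}"
    by (auto simp: subspace_def linear_0[OF assms(1)] linear_add[OF assms(1)] linear_scale[OF assms(1)]
        span_zero span_add span_scale)
  then show ?thesis using span_induct[OF assms(2)] assms(3) by blast
qed

lemma closure_binary_closed:
  assumes f: "continuous_on UNIV (\<lambda>p. f (fst p) (snd p))"
    and "\<And>x y. x \<in> S \<Longrightarrow> y \<in> S \<Longrightarrow> f x y \<in> S" "x \<in> closure S" "y \<in> closure S"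
  shows "f x y \<in> closure S"
proof -
  have "(\<lambda>p. f (fst p) (snd p)) ` closure (S \<times> S) \<subseteq> closure S"
    using assms(2) closure_subset by (intro image_closure_subset continuous_on_subset[OF f]) fastforce+
  then show ?thesis using assms(3,4) by (force simp: closure_Times)
qed

lemma closure_star_subalgebra:
  fixes S :: "'a::cstar_algebra set"
  assumes S: "star_subalgebra S"
  shows "cstar_subalgebra (closure S)"
  unfolding cstar_subalgebra_def star_subalgebra_def
proof (intro conjI ballI allI)
  show "1 \<in> closure S" using S closure_subset by (auto simp: star_subalgebra_def)
  fix x assume x: "x \<in> closure S"
  show "x + y \<in> closure S" if "y \<in> closure S" for y
    by (rule closure_binary_closed[of "(+)"]) (use S x that in \<open>auto simp: star_subalgebra_def intro!: continuous_intros\<close>)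
  show "x * y \<in> closure S" if "y \<in> closure S" for y
    by (rule closure_binary_closed[of "(*)"]) (use S x that in \<open>auto simp: star_subalgebra_def intro!: continuous_intros\<close>)
  show "adj x \<in> closure S"
    by (rule closure_binary_closed[of "\<lambda>x _. adj x" S x x]) (use S x in \<open>auto simp: star_subalgebra_def intro!: continuous_intros\<close>)
  show "cmul c x \<in> closure S" for c
    by (rule closure_binary_closed[of "\<lambda>x _. cmul c x" S x x])
       (use S x in \<open>auto simp: star_subalgebra_def intro!: bounded_linear.continuous_on[OF bounded_linear_cmul] continuous_intros\<close>)
qed simp

text \<open>\<open>span\<close> is the real span; complex multiples stay inside because
  \<open>cmul \<i> n\<close> normalizes \<open>B\<close> whenever \<open>n\<close> does.\<close>

lemma star_subalgebra_span_normalizer: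
  fixes B :: "'a::cstar_algebra set"
  assumes B: "cstar_subalgebra B"
  shows "star_subalgebra (span (normalizer B))"
  unfolding star_subalgebra_def
proof (intro conjI ballI allI)
  let ?N = "normalizer B"
  have "1 \<in> ?N" using unitary_group_subset_normalizer[OF B] cstar_subalgebraD(1)[OF B]
    by (auto simp: unitary_group_def unitary_def)
  then show "1 \<in> span ?N" by (rule span_base)
  fix x assume x: "x \<in> span ?N"
  show "x + y \<in> span ?N" if "y \<in> span ?N" for y using x that by (rule span_add)
  show "adj x \<in> span ?N"
    by (rule linear_span_closed[OF bounded_linear.linear[OF bounded_linear_adj] x]) (simp add: normalizer_adj span_base)
  show "cmul c x \<in> span ?N" for c
  proof (rule linear_span_closed[OF bounded_linear.linear[OF bounded_linear_cmul] x])
    fix n assume n: "n \<in> ?N"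
    have "cmul c n = cmul (complex_of_real (Re c) + complex_of_real (Im c) * \<i>) n"
      by (simp add: mult.commute flip: complex_eq)
    also have "\<dots> = Re c *\<^sub>R n + Im c *\<^sub>R cmul \<i> n"
      by (simp only: cmul_add_left cmul_mult_scal cmul_of_real)
    finally show "cmul c n \<in> span ?N"
      using n by (simp add: span_add span_scale span_base cmul_i_normalizer)
  qed
  show "x * y \<in> span ?N" if y: "y \<in> span ?N" for y
  proof (rule linear_span_closed[OF bounded_linear.linear[OF bounded_linear_mult_left] x])
    fix n assume n: "n \<in> ?N"
    show "n * y \<in> span ?N"
      by (rule linear_span_closed[OF bounded_linear.linear[OF bounded_linear_mult_right] y])
         (simp add: n normalizer_mult span_base)
  qed
qed

lemma closure_span_normalizer:
  fixes B :: "'a::cstar_algebra set"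
  assumes "cstar_subalgebra B" "regular_incl B"
  shows "closure (span (normalizer B)) = UNIV"
proof -
  have "cstar_generated (normalizer B) \<subseteq> closure (span (normalizer B))"
    unfolding cstar_generated_def
    using closure_star_subalgebra[OF star_subalgebra_span_normalizer[OF assms(1)]] closure_subset span_superset
    by blast
  then show ?thesis using assms(2) by (auto simp: regular_incl_def)
qed

section \<open>States\<close>

lemma state_nonneg_real:
  assumes "state_on B \<omega>" "b \<in> B"
  shows "\<omega> (adj b * b) \<in> \<real>\<^sub>\<ge>\<^sub>0"
  using assms by (auto simp: state_on_def complex_nonneg_Reals_iff complex_is_Real_iff)

text \<open>For self-adjoint \<open>g\<close> in \<open>B\<close> of norm below 1,
  \<open>1 - g\<close> is the square of a self-adjoint element of \<open>B\<close>, so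
  \<open>\<omega>\<close> is nonnegative on it. Rescaling to norm at most 1/2 costs a factor 2, and
  adding the real and imaginary parts another 2.\<close>

lemma state_bounded:
  fixes B :: "'a::cstar_algebra set"
  assumes B: "cstar_subalgebra B" and st: "state_on B \<omega>" and b: "b \<in> B"
  shows "cmod (\<omega> b) \<le> 4 * norm b"
proof -
  note BD = cstar_subalgebraD[OF B]
  have add: "\<omega> (x + y) = \<omega> x + \<omega> y" and cm: "\<omega> (cmul c x) = c * \<omega> x" if "x \<in> B" "y \<in> B" for x y c
    using st that by (auto simp: state_on_def)
  have sa1: "cmod (\<omega> h) \<le> 1" if h: "h \<in> B" "adj h = h" "norm h < 1" for h
  proof -
    have *: "1 - \<omega> g \<in> \<real>\<^sub>\<ge>\<^sub>0" if g: "g \<in> B" "adj g = g" "norm g < 1" for g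
    proof -
      obtain r where r: "adj r = r" "r * r = 1 - g" "r \<in> B"
        using sqrt_one_minus[OF g(2,3)] g(1) B by metis
      have "\<omega> (adj r * r) = \<omega> (1 + cmul (-1) g)" using r by simp
      also have "\<dots> = 1 - \<omega> g"
        using add[OF BD(1) BD(9)[OF g(1)]] cm[OF g(1) g(1), of "-1"] st by (simp add: state_on_def)
      finally show ?thesis using state_nonneg_real[OF st r(3)] by simp
    qed
    have "\<omega> (- h) = - \<omega> h" using cm[OF h(1) h(1), of "-1"] by simp
    then have "1 - \<omega> h \<in> \<real>\<^sub>\<ge>\<^sub>0" "1 + \<omega> h \<in> \<real>\<^sub>\<ge>\<^sub>0" using *[of h] *[of "- h"] h BD(9) by auto
    then have "Im (\<omega> h) = 0" "\<bar>Re (\<omega> h)\<bar> \<le> 1" by (auto simp: complex_nonneg_Reals_iff)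
    then show ?thesis using cmod_eq_Re by simp
  qed
  have sa: "cmod (\<omega> h) \<le> 2 * norm b" if h: "h \<in> B" "adj h = h" "norm h \<le> norm b" for h
  proof (cases "b = 0")
    case True
    then show ?thesis using h cm[OF h(1) h(1), of 0] by simp
  next
    case False
    define s where "s = 1 / (2 * norm b)"
    have s: "s > 0" using False by (simp add: s_def)
    have "0 < norm b" "norm h < norm b * 2" using False h(3) by (auto simp: order.strict_trans1)
    then have "cmod (\<omega> (s *\<^sub>R h)) \<le> 1"
      by (intro sa1) (use h False BD in \<open>auto simp: s_def field_simps\<close>)
    moreover have "\<omega> (s *\<^sub>R h) = of_real s * \<omega> h"
      using cm[OF h(1) h(1), of "of_real s"] by (simp add: cmul_of_real)
    ultimately have "s * cmod (\<omega> h) \<le> 1" using s by (simp add: norm_mult)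
    then show ?thesis using False by (simp add: s_def field_simps)
  qed
  obtain h k where hk: "adj h = h" "adj k = k" "b = h + cmul \<i> k" "norm h \<le> norm b" "norm k \<le> norm b"
      "h = (1/2) *\<^sub>R (b + adj b)" "k = cmul (- \<i> / 2) (b - adj b)"
    by (rule cartesian_decomposition[of b])
  have hkB: "h \<in> B" "k \<in> B" unfolding hk(6,7) by (intro BD b)+
  have "\<omega> b = \<omega> h + \<i> * \<omega> k"
    using add[OF hkB(1) BD(5)[OF hkB(2)], of \<i>] cm[OF hkB(2) hkB(2), of \<i>] hk(3) by simp
  then have "cmod (\<omega> b) \<le> cmod (\<omega> h) + cmod (\<omega> k)"
    using norm_triangle_ineq[of "\<omega> h" "\<i> * \<omega> k"] by (simp add: norm_mult)
  then show ?thesis using sa[OF hkB(1) hk(1,4)] sa[OF hkB(2) hk(2,5)] by linarith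
qed

section \<open>Coset representatives as a quasi-basis\<close>

text \<open>The element \<open>w\<^sup>* E(w)\<close> lies in the relative commutant of \<open>B\<close>, because \<open>w b = (w b w\<^sup>*) w\<close>.\<close>

lemma (in conditional_expectation) E_normalizer:
  assumes irr: "irreducible_incl B" and w: "w \<in> normalizer B" "w \<notin> B"
  shows "E w = 0"
proof -
  note wu = unitaryD[OF normalizer_unitary[OF w(1)]]
  have "(adj w * E w) * b = b * (adj w * E w)" if b: "b \<in> B" for b
  proof -
    have "E w * b = E (w * b)" by (simp add: E_mult_right[OF irr b])
    also have "w * b = (w * b * adj w) * w" by (simp add: mult.assoc wu)
    also have "E \<dots> = (w * b * adj w) * E w" by (rule E_mult_left[OF irr normalizer_conj[OF w(1) b]])
    finally show ?thesis by (simp add: mult.assoc wu)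
  qed
  then obtain c where "adj w * E w = cmul c 1" using irr unfolding irreducible_incl_def by blast
  then have "w * (adj w * E w) = w * cmul c 1" by simp
  then have c: "E w = cmul c w" by (simp add: wu)
  show ?thesis
  proof (cases "c = 0")
    case False
    then have "w = cmul (1 / c) (E w)" by (simp add: c)
    then have "w \<in> B" using B_closed(5)[OF E_in] by metis
    then show ?thesis using w(2) by blast
  qed (simp add: c)
qed

locale weyl_representatives = conditional_expectation B E
  for B :: "'a::cstar_algebra set" and E +
  fixes u :: "'a set \<Rightarrow> 'a"
  assumes irreducible: "irreducible_incl B"
    and representative: "g \<in> weyl_group B \<Longrightarrow> u g \<in> g"
begin

lemmas E_left = E_mult_left[OF irreducible]
lemmas E_right = E_mult_right[OF irreducible]

section \<open>Cosets and orthonormality\<close>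

lemma one_unitary_group: "1 \<in> unitary_group B"
  by (simp add: unitary_group_def unitary_def B_closed)

lemma unitary_group_mult: "v \<in> unitary_group B \<Longrightarrow> w \<in> unitary_group B \<Longrightarrow> v * w \<in> unitary_group B"
  by (simp add: unitary_group_def unitary_mult B_closed)

lemma unitary_group_adj: "v \<in> unitary_group B \<Longrightarrow> adj v \<in> unitary_group B"
  by (simp add: unitary_group_def unitary_adj B_closed)

lemma coset_mult:
  assumes v: "v \<in> unitary_group B"
  shows "(\<lambda>x. n * v * x) ` unitary_group B = (\<lambda>x. n * x) ` unitary_group B"
proof (intro equalityI image_subsetI)
  fix x assume x: "x \<in> unitary_group B"
  show "n * v * x \<in> (\<lambda>x. n * x) ` unitary_group B"
    using unitary_group_mult[OF v x] by (simp add: mult.assoc)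
  have "n * x = n * v * (adj v * x)"
    using v unitaryD[of v] by (simp add: unitary_group_def mult.assoc)
  then show "n * x \<in> (\<lambda>x. n * v * x) ` unitary_group B"
    using unitary_group_mult[OF unitary_group_adj[OF v] x] by blast
qed

lemma representative_normalizer: "g \<in> weyl_group B \<Longrightarrow> u g \<in> normalizer B"
  and representative_coset: "g \<in> weyl_group B \<Longrightarrow> g = (\<lambda>v. u g * v) ` unitary_group B"
proof -
  assume g: "g \<in> weyl_group B"
  then obtain n where n: "n \<in> normalizer B" "g = (\<lambda>v. n * v) ` unitary_group B"
    by (auto simp: weyl_group_def)
  then obtain v where v: "v \<in> unitary_group B" "u g = n * v" using representative[OF g] by auto
  show "u g \<in> normalizer B"
    using v n(1) unitary_group_subset_normalizer[OF subalgebra] by (auto intro: normalizer_mult)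
  show "g = (\<lambda>v. u g * v) ` unitary_group B"
    unfolding v(2) coset_mult[OF v(1)] by (rule n(2))
qed

lemma representative_unitary: "g \<in> weyl_group B \<Longrightarrow> unitary (u g)"
  by (rule normalizer_unitary[OF representative_normalizer])

lemma normalizer_representative:
  assumes n: "n \<in> normalizer B"
  obtains g v where "g \<in> weyl_group B" "v \<in> unitary_group B" "n = u g * v"
proof -
  define g where "g = (\<lambda>v. n * v) ` unitary_group B"
  have g: "g \<in> weyl_group B" using n by (auto simp: weyl_group_def g_def)
  have "n \<in> g" unfolding g_def using one_unitary_group by force
  then show ?thesis using that[OF g] representative_coset[OF g] by auto
qed

lemma E_orthonormal:
  assumes g: "g \<in> weyl_group B" and h: "h \<in> weyl_group B"
  shows "E (adj (u g) * u h) = (if g = h then 1 else 0)"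
proof (cases "g = h")
  case False
  let ?w = "adj (u g) * u h"
  have w: "?w \<in> normalizer B"
    using g h by (intro normalizer_mult normalizer_adj representative_normalizer)
  \<comment> \<open>A normalizing unitary that lies in \<open>B\<close> belongs to
    \<open>unitary_group B\<close>, which would make the two cosets equal.\<close>
  have "?w \<notin> B"
  proof
    assume "?w \<in> B"
    then have v: "?w \<in> unitary_group B" using normalizer_unitary[OF w] by (simp add: unitary_group_def)
    have "u h = u g * ?w" using unitaryD[OF representative_unitary[OF g]] by simp
    then have "h = (\<lambda>v. u g * v) ` unitary_group B"
      using representative_coset[OF h] coset_mult[OF v, of "u g"] by simp
    then show False using False representative_coset[OF g] by simp
  qed
  then show ?thesis using E_normalizer[OF irreducible w] False by simp
qed (use unitaryD[OF representative_unitary[OF h]] in simp)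

section \<open>Partial sums and Bessel's identity\<close>

definition partial_sum :: "'a set set \<Rightarrow> 'a \<Rightarrow> 'a" where
  "partial_sum F x = (\<Sum>g\<in>F. u g * E (adj (u g) * x))"

lemma partial_sum_add: "partial_sum F (x + y) = partial_sum F x + partial_sum F y"
  and partial_sum_scaleR: "partial_sum F (r *\<^sub>R x) = r *\<^sub>R partial_sum F x"
  by (simp_all add: partial_sum_def E_add E_scaleR distrib_left sum.distrib scaleR_sum_right)

lemma partial_sum_diff: "partial_sum F (x - y) = partial_sum F x - partial_sum F y"
  by (simp add: partial_sum_def E_diff right_diff_distrib sum_subtractf)

text \<open>For \<open>n = u g * v\<close> with \<open>v\<close> a unitary of \<open>B\<close>,
  orthonormality leaves only the term at \<open>g\<close>, which is \<open>n\<close>. Asking for the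
  identity on all larger \<open>F\<close> makes the property pass to sums through unions.\<close>

lemma partial_sum_span:
  assumes "x \<in> span (normalizer B)"
  obtains F0 where "finite F0" "F0 \<subseteq> weyl_group B"
    "\<And>F. finite F \<Longrightarrow> F0 \<subseteq> F \<Longrightarrow> F \<subseteq> weyl_group B \<Longrightarrow> partial_sum F x = x"
proof -
  define Q where "Q x F0 \<longleftrightarrow> finite F0 \<and> F0 \<subseteq> weyl_group B \<and>
    (\<forall>F. finite F \<and> F0 \<subseteq> F \<and> F \<subseteq> weyl_group B \<longrightarrow> partial_sum F x = x)" for x F0
  have "Q 0 {}" by (simp add: Q_def partial_sum_def)
  moreover have "Q (x + y) (F \<union> G)" if "Q x F" "Q y G" for x y F G
    using that by (simp add: Q_def partial_sum_add)
  moreover have "Q (r *\<^sub>R x) F" if "Q x F" for r x F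
    using that by (simp add: Q_def partial_sum_scaleR)
  ultimately have sub: "subspace {x. \<exists>F. Q x F}" unfolding subspace_def by blast
  have "\<exists>F. Q n F" if n: "n \<in> normalizer B" for n
  proof -
    obtain g v where gv: "g \<in> weyl_group B" "v \<in> unitary_group B" "n = u g * v"
      by (rule normalizer_representative[OF n])
    have "partial_sum F n = n" if F: "finite F" "{g} \<subseteq> F" "F \<subseteq> weyl_group B" for F
    proof -
      have "u h * E (adj (u h) * n) = (if h = g then n else 0)" if "h \<in> F" for h
        using that gv F E_orthonormal[of h g] E_right[of v "adj (u h) * u g"]
        by (cases "h = g") (simp_all add: unitary_group_def mult.assoc subset_eq)
      then have "partial_sum F n = (\<Sum>h\<in>F. if h = g then n else 0)" by (simp add: partial_sum_def)
      then show ?thesis using F by simp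
    qed
    then show ?thesis using gv(1) by (intro exI[of _ "{g}"]) (auto simp: Q_def)
  qed
  then have "span (normalizer B) \<subseteq> {x. \<exists>F. Q x F}" by (intro span_minimal sub) blast
  then obtain F0 where F0: "Q x F0" using assms by blast
  show ?thesis by (rule that[of F0]) (use F0 in \<open>simp_all add: Q_def\<close>)
qed

text \<open>Pythagoras for the \<open>B\<close>-valued inner product \<open>E (adj x * y)\<close>:
  the \<open>u g\<close> are orthonormal, and \<open>E (adj (u g) * x)\<close> are the Fourier
  coefficients of \<open>x\<close>.\<close>

lemma E_partial_sum:
  assumes F: "finite F" "F \<subseteq> weyl_group B"
  shows "E (adj x * partial_sum F x) = (\<Sum>g\<in>F. adj (E (adj (u g) * x)) * E (adj (u g) * x))"
    and "E (adj (x - partial_sum F x) * (x - partial_sum F x))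
      = E (adj x * x) - (\<Sum>g\<in>F. adj (E (adj (u g) * x)) * E (adj (u g) * x))"
proof -
  define b where "b g = E (adj (u g) * x)" for g
  define s where "s = partial_sum F x"
  have s: "s = (\<Sum>g\<in>F. u g * b g)" by (simp add: s_def partial_sum_def b_def)
  have bB: "b g \<in> B" for g by (simp add: b_def E_in)
  let ?S = "\<Sum>g\<in>F. adj (b g) * b g"
  have "E (adj x * (u g * b g)) = adj (b g) * b g" for g
    using E_right[OF bB, of "adj x * u g" g] E_adj[of "adj (u g) * x"]
    by (simp add: adj_mult adj_adj mult.assoc flip: b_def)
  then have xs: "E (adj x * s) = ?S" by (simp add: s sum_distrib_left E_sum)
  have ug: "E (adj (u g) * s) = b g" if "g \<in> F" for g
  proof -
    have "E (adj (u g) * (u h * b h)) = (if h = g then b h else 0)" if "h \<in> F" for h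
      using E_right[OF bB, of "adj (u g) * u h" h] E_orthonormal[of g h] F \<open>g \<in> F\<close> that
      by (cases "h = g") (simp_all add: mult.assoc subset_eq)
    then have "E (adj (u g) * s) = (\<Sum>h\<in>F. if h = g then b h else 0)"
      by (simp add: s sum_distrib_left E_sum)
    then show ?thesis using F that by simp
  qed
  have E_adj_s: "E (adj s * y) = (\<Sum>g\<in>F. adj (b g) * E (adj (u g) * y))" for y
    using E_left[OF B_closed(4)[OF bB]]
    by (simp add: s adj_sum adj_mult sum_distrib_right E_sum mult.assoc)
  have "E (adj s * s) = ?S" "E (adj s * x) = ?S"
    using ug by (simp_all add: E_adj_s b_def)
  then show "E (adj x * partial_sum F x) = (\<Sum>g\<in>F. adj (E (adj (u g) * x)) * E (adj (u g) * x))"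
    and "E (adj (x - partial_sum F x) * (x - partial_sum F x))
      = E (adj x * x) - (\<Sum>g\<in>F. adj (E (adj (u g) * x)) * E (adj (u g) * x))"
    using xs by (simp_all add: s_def[symmetric] b_def[symmetric] adj_diff left_diff_distrib right_diff_distrib E_diff)
qed

section \<open>Scalar estimates for a fixed state, and convergence\<close>

context
  fixes \<omega> assumes state: "state_on B \<omega>"
begin

lemma bounded_linear_state_E: "bounded_linear (\<lambda>x. \<omega> (E x))"
proof (rule bounded_linear_intro[where K = 4])
  show "\<omega> (E (x + y)) = \<omega> (E x) + \<omega> (E y)" for x y
    using state by (simp add: E_add E_in state_on_def)
  show "\<omega> (E (r *\<^sub>R x)) = r *\<^sub>R \<omega> (E x)" for r x
    using state by (simp only: E_cmul E_in state_on_def scaleR_conv_of_real[where 'a = complex] flip: cmul_of_real)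
  show "cmod (\<omega> (E x)) \<le> norm x * 4" for x
    using state_bounded[OF subalgebra state E_in, of x] E_norm[of x] by linarith
qed

lemma state_E_partial_sum:
  assumes F: "finite F" "F \<subseteq> weyl_group B"
  shows "\<omega> (E (adj x * partial_sum F x)) \<in> \<real>\<^sub>\<ge>\<^sub>0"
    and "Re (\<omega> (E (adj (x - partial_sum F x) * (x - partial_sum F x)))) \<le> Re (\<omega> (E (adj x * x)))"
proof -
  define b where "b g = E (adj (u g) * x)" for g
  have "\<omega> (E (\<Sum>g\<in>F. adj (b g) * b g)) = (\<Sum>g\<in>F. \<omega> (E (adj (b g) * b g)))"
    by (rule linear_sum[OF bounded_linear.linear[OF bounded_linear_state_E]])
  then have S: "\<omega> (\<Sum>g\<in>F. adj (b g) * b g) = (\<Sum>g\<in>F. \<omega> (adj (b g) * b g))"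
    by (simp add: E_sum E_id E_in B_closed b_def)
  have "(\<Sum>g\<in>F. \<omega> (adj (b g) * b g)) \<in> \<real>\<^sub>\<ge>\<^sub>0"
    using state_nonneg_real[OF state E_in] by (simp add: b_def complex_nonneg_Reals_iff sum_nonneg)
  then show *: "\<omega> (E (adj x * partial_sum F x)) \<in> \<real>\<^sub>\<ge>\<^sub>0"
    unfolding E_partial_sum[OF F] b_def[symmetric] S .
  have "E (adj (x - partial_sum F x) * (x - partial_sum F x)) = E (adj x * x - adj x * partial_sum F x)"
    by (simp only: E_partial_sum[OF F] E_diff)
  then have "\<omega> (E (adj (x - partial_sum F x) * (x - partial_sum F x)))
      = \<omega> (E (adj x * x)) - \<omega> (E (adj x * partial_sum F x))"
    using linear_diff[OF bounded_linear.linear[OF bounded_linear_state_E]] by simp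
  then show "Re (\<omega> (E (adj (x - partial_sum F x) * (x - partial_sum F x)))) \<le> Re (\<omega> (E (adj x * x)))"
    using * by (simp add: complex_nonneg_Reals_iff)
qed

text \<open>On the dense span of the normalizer \<open>x\<close> is a partial sum, so \<open>E (x\<^sup>* x)\<close> is visibly a sum of
  positive elements of \<open>B\<close>; this avoids the positivity of \<open>x\<^sup>* x\<close> in abstract C*-algebras.\<close>

lemma state_E_nonneg:
  assumes regular: "regular_incl B"
  shows "\<omega> (E (adj x * x)) \<in> \<real>\<^sub>\<ge>\<^sub>0"
proof -
  have "(\<lambda>x. \<omega> (E (adj x * x))) ` closure (span (normalizer B)) \<subseteq> \<real>\<^sub>\<ge>\<^sub>0"
  proof (rule image_closure_subset)
    show "continuous_on (closure (span (normalizer B))) (\<lambda>x. \<omega> (E (adj x * x)))"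
      by (intro bounded_linear.continuous_on[OF bounded_linear_state_E] continuous_intros)
    show "(\<lambda>x. \<omega> (E (adj x * x))) ` span (normalizer B) \<subseteq> \<real>\<^sub>\<ge>\<^sub>0"
    proof (rule image_subsetI)
      fix x assume "x \<in> span (normalizer B)"
      then obtain F where "finite F" "F \<subseteq> weyl_group B" "partial_sum F x = x"
        using partial_sum_span by (metis order_refl)
      then show "\<omega> (E (adj x * x)) \<in> \<real>\<^sub>\<ge>\<^sub>0" using state_E_partial_sum(1)[of F x] by simp
    qed
  qed (rule closed_nonneg_Reals_complex)
  then show ?thesis by (auto simp: closure_span_normalizer[OF subalgebra regular])
qed

text \<open>Approximate \<open>x\<close> in norm by \<open>y\<close> in the span. Once
  \<open>F\<close> contains \<open>F0\<close>, the remainder of \<open>x\<close> is that of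
  \<open>z = x - y\<close>, and Bessel bounds its seminorm by that of \<open>z\<close>, uniformly in
  \<open>F\<close>.\<close>

lemma partial_sum_tendsto:
  assumes regular: "regular_incl B"
  shows "((\<lambda>F. \<omega> (E (adj (x - partial_sum F x) * (x - partial_sum F x)))) \<longlongrightarrow> 0)
    (finite_subsets_at_top (weyl_group B))"
proof (rule tendstoI)
  fix e :: real assume e: "e > 0"
  \<comment> \<open>\<open>4 * \<delta>\<^sup>2 = e / 2\<close>, where 4 is the bound for
    \<open>\<omega>\<close> from \<open>state_bounded\<close>.\<close>
  define \<delta> where "\<delta> = sqrt (e / 8)"
  have \<delta>: "\<delta> > 0" "4 * \<delta>\<^sup>2 < e" using e by (simp_all add: \<delta>_def)
  have "x \<in> closure (span (normalizer B))" by (simp add: closure_span_normalizer[OF subalgebra regular])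
  then obtain y where y: "y \<in> span (normalizer B)" "dist y x < \<delta>"
    using \<delta>(1) closure_approachable by blast
  obtain F0 where F0: "finite F0" "F0 \<subseteq> weyl_group B"
    "\<And>F. finite F \<Longrightarrow> F0 \<subseteq> F \<Longrightarrow> F \<subseteq> weyl_group B \<Longrightarrow> partial_sum F y = y"
    using partial_sum_span[OF y(1)] by metis
  define z where "z = x - y"
  have z: "norm z < \<delta>" using y(2) by (simp add: z_def dist_norm norm_minus_commute)
  have "cmod (\<omega> (E (adj (x - partial_sum F x) * (x - partial_sum F x)))) < e"
    if F: "finite F" "F0 \<subseteq> F" "F \<subseteq> weyl_group B" for F
  proof -
    let ?v = "x - partial_sum F x"
    have v: "?v = z - partial_sum F z" by (simp add: z_def partial_sum_diff F0(3)[OF F])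
    have "cmod (\<omega> (E (adj ?v * ?v))) = Re (\<omega> (E (adj ?v * ?v)))"
      using state_E_nonneg[OF regular, of ?v] by (simp add: complex_nonneg_Reals_iff cmod_eq_Re)
    also have "\<dots> \<le> Re (\<omega> (E (adj z * z)))"
      unfolding v by (rule state_E_partial_sum(2)[OF F(1,3)])
    also have "\<dots> \<le> cmod (\<omega> (E (adj z * z)))" by (rule complex_Re_le_cmod)
    also have "\<dots> \<le> 4 * norm (E (adj z * z))" by (rule state_bounded[OF subalgebra state E_in])
    also have "\<dots> \<le> 4 * (norm z)\<^sup>2" using E_norm[of "adj z * z"] by (simp add: cstar_identity)
    also have "\<dots> \<le> 4 * \<delta>\<^sup>2" using z by (simp add: power_mono)
    finally show ?thesis using \<delta>(2) by simp
  qed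
  then show "\<forall>\<^sub>F F in finite_subsets_at_top (weyl_group B).
      dist (\<omega> (E (adj (x - partial_sum F x) * (x - partial_sum F x)))) 0 < e"
    using F0(1,2) unfolding eventually_finite_subsets_at_top by auto
qed

end

end

theorem theorem3p4:
  fixes B :: "'a::cstar_algebra set"
    and E :: "'a \<Rightarrow> 'a"
    and u :: "'a set \<Rightarrow> 'a"
  assumes "cstar_subalgebra B"
    and "simple_in (UNIV :: 'a set)"
    and "simple_in B"
    and "regular_incl B"
    and "irreducible_incl B"
    and "cond_exp B E"
    and "faithful_ce E"
    and "\<forall>g\<in>weyl_group B. u g \<in> g"
    and "u (unitary_group B) = 1"
  shows "(\<forall>g\<in>weyl_group B. unitary (u g))
     \<and> (\<forall>g\<in>weyl_group B. \<forall>h\<in>weyl_group B.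
          E (adj (u g) * u h) = (if g = h then 1 else 0))
     \<and> (\<forall>x. bures_has_sum B E (\<lambda>g. u g * E (adj (u g) * x)) (weyl_group B) x)"
proof -
  interpret weyl_representatives B E u
    using assms by unfold_locales auto
  show ?thesis
    using representative_unitary E_orthonormal partial_sum_tendsto[OF _ assms(4)]
    unfolding bures_has_sum_def partial_sum_def by blast
qed

end
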